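(* Let $W=(W_1,\dots,W_n)$ be a vector of real-valued random variables, let $\mathcal K\subseteq[n]$ be a random subset, and let $\mathcal N$, $L$, $\mathcal G^{\mathcal N}$ and $\langle\mathcal G^{\mathcal N}\rangle$ be as defined in the context, for a collection $\mathcal G$ of bijections $[n]\to[n]$. Suppose that $$gL\stackrel d=L\quad\text{for all } g\in\mathcal G^{\mathcal N},$$ and that $\langle\mathcal G^{\mathcal N}\rangle$ is transitive: for every $x,y\in\mathcal N$ there exists $h\in\langle\mathcal G^{\mathcal N}\rangle$ with $h(x)=y$. Then, for any $i\in\mathcal N$ and any $t\in[0,1]$, $$P\left(\frac1{|\mathcal K|}\sum_{k\in\mathcal K}\mathbf 1(W_k\ge W_i)\le t\ \Big|\ i\in\mathcal K\right)\le t.$$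
   Context: $[n]=\{1,\dots,n\}$. Let $\zeta_k=\mathbf 1(k\in\mathcal K)$ be the inclusion indicators, $\mathcal N=\{k\in[n]:P(\zeta_k=1)>0\}$, and $L=(L_k)_{k\in\mathcal N}$ with $L_k=(W_k,\zeta_k)$. For a bijection $g$ of $\mathcal N$, $gL=(L_{g(k)})_{k\in\mathcal N}$. Define $$\mathcal G^{\mathcal N}=\{g|_{\mathcal N}: g\in\mathcal G,\ g|_{\mathcal N}\text{ is a bijection of }\mathcal N\}.$$ $\langle\mathcal G^{\mathcal N}\rangle$ denotes the collection of all finite compositions $h=h_1\circ\cdots\circ h_m$, where for each $\ell$ either $h_\ell\in\mathcal G^{\mathcal N}$ or $h_\ell^{-1}\in\mathcal G^{\mathcal N}$, together with the identity. *)

theory Defs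
  imports "HOL-Probability.Probability" "HOL-Algebra.Bij" "HOL-Algebra.Generated_Groups"
begin

definition incl_ind :: "('a \<Rightarrow> nat set) \<Rightarrow> nat \<Rightarrow> 'a \<Rightarrow> real" where
  "incl_ind K k \<omega> = indicator (K \<omega>) k"

definition incl_support :: "'a measure \<Rightarrow> nat \<Rightarrow> ('a \<Rightarrow> nat set) \<Rightarrow> nat set" where
  "incl_support M n K = {k \<in> {1..n}. \<P>(\<omega> in M. incl_ind K k \<omega> = 1) > 0}"

text \<open>Vectors indexed by a finite set \<open>N\<close> are extensional functions, i.e. elements of a product
  space \<open>Pi\<^sub>M N\<close>.\<close>

definition labelled :: "nat set \<Rightarrow> (nat \<Rightarrow> 'a \<Rightarrow> real) \<Rightarrow> ('a \<Rightarrow> nat set) \<Rightarrow> 'a \<Rightarrow> nat \<Rightarrow> real \<times> real" where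
  "labelled N W K \<omega> = (\<lambda>k\<in>N. (W k \<omega>, incl_ind K k \<omega>))"

definition permute_vec :: "nat set \<Rightarrow> (nat \<Rightarrow> nat) \<Rightarrow> (nat \<Rightarrow> 'b) \<Rightarrow> nat \<Rightarrow> 'b" where
  "permute_vec N g l = (\<lambda>k\<in>N. l (g k))"

definition eq_in_distr :: "'a measure \<Rightarrow> 'b measure \<Rightarrow> ('a \<Rightarrow> 'b) \<Rightarrow> ('a \<Rightarrow> 'b) \<Rightarrow> bool" where
  "eq_in_distr M S X Y \<longleftrightarrow> X \<in> measurable M S \<and> Y \<in> measurable M S \<and> distr M S X = distr M S Y"

definition restricted_bijs :: "nat set \<Rightarrow> (nat \<Rightarrow> nat) set \<Rightarrow> (nat \<Rightarrow> nat) set" where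
  "restricted_bijs N G = {restrict g N |g. g \<in> G \<and> bij_betw g N N}"

text \<open>In \<open>BijGroup N\<close> the product is composition of bijections of \<open>N\<close> and the unit is the identity
  of \<open>N\<close>, so \<open>generate\<close> yields the identity and all finite compositions of given bijections and
  their inverses.\<close>

definition generated_bijs :: "nat set \<Rightarrow> (nat \<Rightarrow> nat) set \<Rightarrow> (nat \<Rightarrow> nat) set" where
  "generated_bijs N H = generate (BijGroup N) H"

end

theory Submission
  imports Defs
begin

text \<open>Call a label vector \<open>l\<close> significant at \<open>j\<close> if \<open>j\<close> is selected and its rank p-value among the
  selected indices is at most \<open>t\<close>. Permuting \<open>l\<close> by \<open>g\<close> moves significance at \<open>j\<close> to significance
  at \<open>g j\<close>, so by invariance and transitivity the probability of significance at \<open>j\<close>, and likewise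
  that of selection of \<open>j\<close>, does not depend on \<open>j \<in> N\<close>. Pointwise, at most a fraction \<open>t\<close> of the
  selected indices is significant, since all significant ones are counted in the p-value of the
  one with the smallest value of \<open>W\<close>. Taking expectations and dividing by \<open>card N\<close> gives the bound.\<close>

section \<open>Rank p-values of label vectors\<close>

definition selected :: "(nat \<Rightarrow> real \<times> real) \<Rightarrow> nat \<Rightarrow> bool" where
  "selected l k \<longleftrightarrow> snd (l k) = 1"

text \<open>The sums run over the fixed set \<open>N\<close>, with membership in the random set read
  off the labels, so that the p-value is a function of the label vector alone and equality in
  distribution applies to it. An empty selection gives 0, by \<open>1 / 0 = 0\<close>;
  \<open>significant\<close> excludes that case for \<open>j \<in> N\<close> by asking that
  \<open>j\<close> be selected.\<close>

definition rank_pvalue :: "nat set \<Rightarrow> (nat \<Rightarrow> real \<times> real) \<Rightarrow> nat \<Rightarrow> real" where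
  "rank_pvalue N l j =
     1 / (\<Sum>k\<in>N. of_bool (selected l k)) *
     (\<Sum>k\<in>N. of_bool (selected l k \<and> fst (l j) \<le> fst (l k)))"

definition significant :: "nat set \<Rightarrow> real \<Rightarrow> (nat \<Rightarrow> real \<times> real) \<Rightarrow> nat \<Rightarrow> bool" where
  "significant N t l j \<longleftrightarrow> selected l j \<and> rank_pvalue N l j \<le> t"

lemma selected_permute_vec:
  "j \<in> N \<Longrightarrow> selected (permute_vec N g l) j \<longleftrightarrow> selected l (g j)"
  by (simp add: selected_def permute_vec_def)

text \<open>A bijection of \<open>N\<close> only reindexes the two sums over \<open>N\<close>; what
  remains of the permutation is the shift of the reference index from \<open>j\<close> to
  \<open>g j\<close>.\<close>

lemma rank_pvalue_permute_vec:
  assumes g: "bij_betw g N N" and j: "j \<in> N"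
  shows "rank_pvalue N (permute_vec N g l) j = rank_pvalue N l (g j)"
proof -
  have "(\<Sum>k\<in>N. of_bool (selected (permute_vec N g l) k))
      = (\<Sum>k\<in>N. of_bool (selected l (g k)) :: real)"
    by (intro sum.cong) (simp_all add: selected_permute_vec)
  also have "\<dots> = (\<Sum>k\<in>N. of_bool (selected l k))"
    by (rule sum.reindex_bij_betw[OF g])
  finally have 1: "(\<Sum>k\<in>N. of_bool (selected (permute_vec N g l) k))
      = (\<Sum>k\<in>N. of_bool (selected l k) :: real)" .
  have "(\<Sum>k\<in>N. of_bool (selected (permute_vec N g l) k
            \<and> fst (permute_vec N g l j) \<le> fst (permute_vec N g l k)))
      = (\<Sum>k\<in>N. of_bool (selected l (g k) \<and> fst (l (g j)) \<le> fst (l (g k))) :: real)"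
    using j by (intro sum.cong) (simp_all add: selected_def permute_vec_def)
  also have "\<dots> = (\<Sum>k\<in>N. of_bool (selected l k \<and> fst (l (g j)) \<le> fst (l k)))"
    by (rule sum.reindex_bij_betw[OF g])
  finally show ?thesis
    by (simp only: rank_pvalue_def 1)
qed

lemma significant_permute_vec:
  "bij_betw g N N \<Longrightarrow> j \<in> N \<Longrightarrow>
    significant N t (permute_vec N g l) j \<longleftrightarrow> significant N t l (g j)"
  by (simp add: significant_def rank_pvalue_permute_vec selected_permute_vec)

lemma sum_significant_le:
  assumes fin: "finite N" and t: "0 \<le> t"
  shows "(\<Sum>j\<in>N. of_bool (significant N t l j)) \<le> t * (\<Sum>j\<in>N. of_bool (selected l j) :: real)"
    (is "_ \<le> t * ?s")
proof (cases "\<exists>j\<in>N. significant N t l j")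
  case False
  then have "(\<Sum>j\<in>N. of_bool (significant N t l j)) = (0::real)"
    by (intro sum.neutral) auto
  then show ?thesis
    using t by (simp add: sum_nonneg)
next
  case True
  define J where "J = {j \<in> N. significant N t l j}"
  have J: "finite J" "J \<noteq> {}"
    using True fin by (auto simp: J_def)
  \<comment> \<open>Since the comparison in the p-value is non-strict, every significant index, ties
    included, is counted in the numerator at \<open>m\<close>.\<close>
  define m where "m = arg_min_on (\<lambda>j. fst (l j)) J"
  have m: "m \<in> J"
    unfolding m_def by (rule arg_min_if_finite(1)[OF J])
  have least: "fst (l m) \<le> fst (l j)" if "j \<in> J" for j
    unfolding m_def using J that by (intro arg_min_least)
  \<comment> \<open>The selected index \<open>m\<close> itself contributes 1, so the denominator of
    its p-value can be cleared.\<close>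
  have "0 < ?s"
    using m fin by (intro sum_pos2[of N m]) (auto simp: J_def significant_def)
  have "(\<Sum>j\<in>N. of_bool (significant N t l j))
      \<le> (\<Sum>k\<in>N. of_bool (selected l k \<and> fst (l m) \<le> fst (l k)) :: real)"
    by (intro sum_mono) (use least in \<open>auto simp: J_def significant_def\<close>)
  also have "\<dots> \<le> t * ?s"
    using m \<open>0 < ?s\<close> by (auto simp: J_def significant_def rank_pvalue_def field_simps)
  finally show ?thesis .
qed

section \<open>Measurability of selection and significance\<close>

lemma measurable_label_component:
  assumes "k \<in> N"
  shows "(\<lambda>l. fst (l k)) \<in> borel_measurable (Pi\<^sub>M N (\<lambda>_. borel :: (real \<times> real) measure))"
    and "(\<lambda>l. snd (l k)) \<in> borel_measurable (Pi\<^sub>M N (\<lambda>_. borel :: (real \<times> real) measure))"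
  using measurable_component_singleton[OF assms, of "\<lambda>_. borel :: (real \<times> real) measure"]
  by (auto simp: borel_prod[symmetric])

lemma measurable_selected:
  assumes "k \<in> N"
  shows "Measurable.pred (Pi\<^sub>M N (\<lambda>_. borel)) (\<lambda>l. selected l k)"
  using measurable_label_component[OF assms] unfolding selected_def by measurable

lemma measurable_significant:
  assumes "j \<in> N"
  shows "Measurable.pred (Pi\<^sub>M N (\<lambda>_. borel)) (\<lambda>l. significant N t l j)"
proof -
  have [measurable]: "Measurable.pred (Pi\<^sub>M N (\<lambda>_. borel))
      (\<lambda>l. selected l k \<and> fst (l j) \<le> fst (l k))" if "k \<in> N" for k
    by (intro pred_intros_logic measurable_selected that
        borel_measurable_le[unfolded pred_def[symmetric]] measurable_label_component(1) assms)
  note [measurable] = measurable_selected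
  have "(\<lambda>l. rank_pvalue N l j) \<in> borel_measurable (Pi\<^sub>M N (\<lambda>_. borel))"
    unfolding rank_pvalue_def of_bool_def by measurable
  then show ?thesis
    using measurable_selected[OF assms] unfolding significant_def by measurable
qed

section \<open>Invariance under the generated bijections\<close>

lemma restricted_bijs_subset_Bij: "restricted_bijs N G \<subseteq> Bij N"
  by (auto simp: restricted_bijs_def Bij_def cong: bij_betw_cong)

text \<open>\<open>c\<close> is an arbitrary quantity indexed by \<open>N\<close>, later the
  probability of an event at \<open>j\<close>. Invariance survives inverses and compositions, so the
  group generated by \<open>H\<close> inherits it.\<close>

lemma generate_BijGroup_invariant:
  assumes H: "H \<subseteq> Bij N" and inv: "\<And>g j. g \<in> H \<Longrightarrow> j \<in> N \<Longrightarrow> c (g j) = c j"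
    and h: "h \<in> generate (BijGroup N) H" and j: "j \<in> N"
  shows "c (h j) = c j"
  using h j
proof (induction arbitrary: j rule: generate.induct)
  case one
  then show ?case by (simp add: BijGroup_def)
next
  case (incl h)
  then show ?case by (rule inv)
next
  case (inv h)
  then have h: "bij_betw h N N" "h \<in> Bij N"
    using H by (auto simp: Bij_def)
  \<comment> \<open>The hypothesis on \<open>h\<close> is applied at the preimage of
    \<open>j\<close>, which turns invariance under \<open>h\<close> into invariance under its
    inverse.\<close>
  then have "inv_into N h j \<in> N"
    using inv(2) by (metis bij_betw_imp_surj_on inv_into_into)
  moreover have "h (inv_into N h j) = j"
    using h inv(2) by (metis bij_betw_inv_into_right)
  ultimately have "c j = c (inv_into N h j)"
    using assms(2)[OF inv(1)] by metis
  then show ?case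
    using h inv(2) by (simp add: inv_BijGroup)
next
  case (eng h1 h2)
  have "h1 \<in> Bij N" "h2 \<in> Bij N"
    using group.generate_incl[OF group_BijGroup, of H N] H eng(1,2) by (auto simp: BijGroup_def)
  \<comment> \<open>The group product is \<open>compose N\<close>, which agrees with composition
    only on \<open>N\<close>; \<open>h2 j\<close> must lie in \<open>N\<close> for the induction
    hypothesis of \<open>h1\<close>.\<close>
  then have "(h1 \<otimes>\<^bsub>BijGroup N\<^esub> h2) j = h1 (h2 j)" "h2 j \<in> N"
    using eng.prems by (auto simp: BijGroup_def compose_def Bij_def bij_betw_def)
  then show ?case
    using eng by simp
qed

text \<open>By \<open>equiv\<close>, the event at \<open>g j\<close> for \<open>X\<close> is the
  event at \<open>j\<close> for the permuted vector, and the latter has the law of \<open>X\<close>.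
  \<open>P\<close> is left general to cover both selection and significance.\<close>

lemma prob_equivariant_invariant:
  assumes eq: "eq_in_distr M S (\<lambda>\<omega>. permute_vec N g (X \<omega>)) X"
    and meas: "Measurable.pred S (\<lambda>l. P l j)"
    and equiv: "\<And>l. P (permute_vec N g l) j \<longleftrightarrow> P l (g j)"
  shows "\<P>(\<omega> in M. P (X \<omega>) (g j)) = \<P>(\<omega> in M. P (X \<omega>) j)"
proof -
  let ?A = "{l \<in> space S. P l j}"
  have X: "X \<in> measurable M S" and gX: "(\<lambda>\<omega>. permute_vec N g (X \<omega>)) \<in> measurable M S"
    and d: "distr M S (\<lambda>\<omega>. permute_vec N g (X \<omega>)) = distr M S X"
    using eq by (auto simp: eq_in_distr_def)
  have A: "?A \<in> sets S"
    using meas by measurable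
  have "\<P>(\<omega> in M. P (X \<omega>) (g j)) = measure (distr M S (\<lambda>\<omega>. permute_vec N g (X \<omega>))) ?A"
    unfolding measure_distr[OF gX A]
    by (intro arg_cong[where f = "measure M"])
      (use measurable_space[OF gX] equiv in auto)
  also have "\<dots> = \<P>(\<omega> in M. P (X \<omega>) j)"
    unfolding d measure_distr[OF X A]
    by (intro arg_cong[where f = "measure M"]) (use measurable_space[OF X] in auto)
  finally show ?thesis .
qed

section \<open>Expectations, and the link between label vectors and \<open>K\<close>\<close>

lemma (in prob_space) sum_prob_le:
  assumes "finite N" and P: "\<And>j. j \<in> N \<Longrightarrow> Measurable.pred M (P j)"
    and Q: "\<And>j. j \<in> N \<Longrightarrow> Measurable.pred M (Q j)"
    and le: "\<And>\<omega>. \<omega> \<in> space M \<Longrightarrow>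
      (\<Sum>j\<in>N. of_bool (P j \<omega>)) \<le> t * (\<Sum>j\<in>N. of_bool (Q j \<omega>) :: real)"
  shows "(\<Sum>j\<in>N. \<P>(\<omega> in M. P j \<omega>)) \<le> t * (\<Sum>j\<in>N. \<P>(\<omega> in M. Q j \<omega>))"
proof -
  have int: "integrable M (\<lambda>\<omega>. of_bool (R \<omega>) :: real)"
    and prob: "expectation (\<lambda>\<omega>. of_bool (R \<omega>)) = \<P>(\<omega> in M. R \<omega>)"
    if R: "Measurable.pred M R" for R
  proof -
    show "integrable M (\<lambda>\<omega>. of_bool (R \<omega>) :: real)"
      using R by (intro integrable_const_bound[where B = 1]) (auto simp: of_bool_def)
    have "expectation (\<lambda>\<omega>. of_bool (R \<omega>)) = expectation (indicator {\<omega> \<in> space M. R \<omega>})"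
      by (intro Bochner_Integration.integral_cong) (auto simp: indicator_def)
    also have "\<dots> = \<P>(\<omega> in M. R \<omega>)"
      using R by simp
    finally show "expectation (\<lambda>\<omega>. of_bool (R \<omega>)) = \<P>(\<omega> in M. R \<omega>)" .
  qed
  have "(\<Sum>j\<in>N. \<P>(\<omega> in M. P j \<omega>)) = expectation (\<lambda>\<omega>. \<Sum>j\<in>N. of_bool (P j \<omega>))"
    using P by (simp add: Bochner_Integration.integral_sum int prob)
  also have "\<dots> \<le> expectation (\<lambda>\<omega>. t * (\<Sum>j\<in>N. of_bool (Q j \<omega>)))"
    using P Q le
    by (intro integral_mono integrable_mult_right Bochner_Integration.integrable_sum int) auto
  also have "\<dots> = t * (\<Sum>j\<in>N. \<P>(\<omega> in M. Q j \<omega>))"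
    using Q by (simp add: Bochner_Integration.integral_sum int prob)
  finally show ?thesis .
qed

text \<open>Every index of \<open>{1..n}\<close> outside the support is selected with probability 0,
  and a finite union of null events is null. This lets sums over \<open>K\<close> be replaced almost
  surely by sums over \<open>N\<close>.\<close>

lemma (in prob_space) AE_subset_incl_support:
  assumes K: "K \<in> measurable M (count_space (Pow {1..n}))"
  shows "AE \<omega> in M. K \<omega> \<subseteq> incl_support M n K"
proof -
  have [measurable]: "Measurable.pred M (\<lambda>\<omega>. k \<in> K \<omega>)" for k
    by (rule measurable_compose[OF K]) simp
  have "AE \<omega> in M. k \<notin> K \<omega>" if "k \<in> {1..n} - incl_support M n K" for k
  proof -
    have "\<P>(\<omega> in M. k \<in> K \<omega>) = 0"
      using that measure_nonneg[of M "{\<omega> \<in> space M. k \<in> K \<omega>}"]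
      by (auto simp: incl_support_def incl_ind_def indicator_eq_1_iff not_less intro: antisym)
    then show ?thesis
      by (subst (asm) prob_Collect_eq_0) auto
  qed
  then have "AE \<omega> in M. \<forall>k\<in>{1..n} - incl_support M n K. k \<notin> K \<omega>"
    by (subst AE_ball_countable) auto
  then show ?thesis
    using AE_space by eventually_elim (use measurable_space[OF K] in fastforce)
qed

lemma selected_labelled: "k \<in> N \<Longrightarrow> selected (labelled N W K \<omega>) k \<longleftrightarrow> k \<in> K \<omega>"
  by (simp add: selected_def labelled_def incl_ind_def indicator_eq_1_iff)

text \<open>Indices of \<open>N\<close> outside \<open>K \<omega>\<close> contribute 0 to both sums,
  and \<open>K \<omega> \<subseteq> N\<close> ensures that no selected index is missed.\<close>

lemma rank_pvalue_labelled:
  assumes "finite N" "K \<omega> \<subseteq> N" "i \<in> N"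
  shows "rank_pvalue N (labelled N W K \<omega>) i =
    1 / real (card (K \<omega>)) * (\<Sum>k\<in>K \<omega>. of_bool (W i \<omega> \<le> W k \<omega>))"
proof -
  have "(\<Sum>k\<in>N. of_bool (selected (labelled N W K \<omega>) k)) = (\<Sum>k\<in>K \<omega>. 1 :: real)"
    using assms by (intro sum.mono_neutral_cong_right) (auto simp: selected_labelled)
  moreover have "(\<Sum>k\<in>N. of_bool (selected (labelled N W K \<omega>) k
        \<and> fst (labelled N W K \<omega> i) \<le> fst (labelled N W K \<omega> k)))
      = (\<Sum>k\<in>K \<omega>. of_bool (W i \<omega> \<le> W k \<omega>) :: real)"
    using assms
    by (intro sum.mono_neutral_cong_right) (auto simp: selected_labelled, auto simp: labelled_def)
  ultimately show ?thesis
    by (simp only: rank_pvalue_def) simp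
qed

theorem theorem5p1:
  fixes M :: "'a measure" and n :: nat
    and W :: "nat \<Rightarrow> 'a \<Rightarrow> real" and K :: "'a \<Rightarrow> nat set"
    and G :: "(nat \<Rightarrow> nat) set" and i :: nat and t :: real
  defines "N \<equiv> incl_support M n K"
  assumes "prob_space M"
    and "\<And>k. k \<in> {1..n} \<Longrightarrow> W k \<in> borel_measurable M"
    and "K \<in> measurable M (count_space (Pow {1..n}))"
    and "\<And>g. g \<in> G \<Longrightarrow> bij_betw g {1..n} {1..n}"
    and "\<And>g. g \<in> restricted_bijs N G \<Longrightarrow>
           eq_in_distr M (Pi\<^sub>M N (\<lambda>_. borel))
             (\<lambda>\<omega>. permute_vec N g (labelled N W K \<omega>)) (labelled N W K)"
    and "\<And>x y. x \<in> N \<Longrightarrow> y \<in> N \<Longrightarrow>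
           \<exists>h \<in> generated_bijs N (restricted_bijs N G). h x = y"
    and "i \<in> N" and "t \<in> {0..1}"
  shows "\<P>(\<omega> in M. 1 / real (card (K \<omega>)) * (\<Sum>k\<in>K \<omega>. of_bool (W k \<omega> \<ge> W i \<omega>)) \<le> t
            \<bar> i \<in> K \<omega>) \<le> t"
proof -
  interpret prob_space M by fact
  note W [measurable] = assms(3)
  note K = assms(4)
  note dist_eq = assms(6)
  note trans = assms(7)
  have i: "i \<in> N" and t: "0 \<le> t"
    using assms(8,9) by auto
  have N: "N \<subseteq> {1..n}" "finite N"
    by (auto simp: N_def incl_support_def)
  let ?S = "Pi\<^sub>M N (\<lambda>_. borel :: (real \<times> real) measure)"
  let ?L = "labelled N W K"
  have K_pred [measurable]: "Measurable.pred M (\<lambda>\<omega>. k \<in> K \<omega>)" for k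
    by (rule measurable_compose[OF K]) simp
  have L [measurable]: "?L \<in> measurable M ?S"
    unfolding labelled_def incl_ind_def indicator_def of_bool_def
    by (intro measurable_restrict borel_measurable_Pair) (use N in auto)
  \<comment> \<open>Transitivity supplies \<open>h\<close> with \<open>h i = j\<close>, and the
    probability at an index is the quantity \<open>c\<close> that \<open>h\<close> leaves
    unchanged.\<close>
  have const: "\<P>(\<omega> in M. P (?L \<omega>) j) = \<P>(\<omega> in M. P (?L \<omega>) i)"
    if meas: "\<And>j. j \<in> N \<Longrightarrow> Measurable.pred ?S (\<lambda>l. P l j)"
      and equiv: "\<And>g l j. bij_betw g N N \<Longrightarrow> j \<in> N \<Longrightarrow> P (permute_vec N g l) j \<longleftrightarrow> P l (g j)"
      and j: "j \<in> N" for P j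
  proof -
    have bij: "restricted_bijs N G \<subseteq> Bij N"
      using restricted_bijs_subset_Bij .
    obtain h where "h \<in> generate (BijGroup N) (restricted_bijs N G)" "h i = j"
      using trans[OF i j] by (auto simp: generated_bijs_def)
    moreover have "\<P>(\<omega> in M. P (?L \<omega>) (g k)) = \<P>(\<omega> in M. P (?L \<omega>) k)"
      if "g \<in> restricted_bijs N G" "k \<in> N" for g k
      using that bij by (intro prob_equivariant_invariant[OF dist_eq] meas equiv) (auto simp: Bij_def)
    ultimately show ?thesis
      using generate_BijGroup_invariant[OF bij, of "\<lambda>j. \<P>(\<omega> in M. P (?L \<omega>) j)" h i] i by simp
  qed
  have sel_i: "\<P>(\<omega> in M. selected (?L \<omega>) i) = \<P>(\<omega> in M. i \<in> K \<omega>)"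
    using i by (simp add: selected_labelled)
  \<comment> \<open>Membership of \<open>i\<close> in the support makes the conditional probability
    a genuine quotient, free of the default value of division by 0.\<close>
  have pos: "0 < \<P>(\<omega> in M. i \<in> K \<omega>)"
    using i by (simp add: N_def incl_support_def incl_ind_def indicator_eq_1_iff)
  have card_N: "0 < real (card N)"
    using N(2) i by (auto simp: card_gt_0_iff)
  \<comment> \<open>By \<open>const\<close> each sum of probabilities over \<open>N\<close> is
    \<open>card N\<close> times its term at \<open>i\<close>, so that \<open>card N\<close> cancels
    in the end.\<close>
  have "real (card N) * \<P>(\<omega> in M. significant N t (?L \<omega>) i)
      = (\<Sum>j\<in>N. \<P>(\<omega> in M. significant N t (?L \<omega>) j))"
    by (simp add: const[of "significant N t"] measurable_significant significant_permute_vec)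
  also have "\<dots> \<le> t * (\<Sum>j\<in>N. \<P>(\<omega> in M. selected (?L \<omega>) j))"
    using N(2) t
    by (intro sum_prob_le sum_significant_le measurable_compose[OF L] measurable_significant
        measurable_selected)
  also have "(\<Sum>j\<in>N. \<P>(\<omega> in M. selected (?L \<omega>) j)) = real (card N) * \<P>(\<omega> in M. i \<in> K \<omega>)"
    by (simp add: const[of selected] measurable_selected selected_permute_vec sel_i)
  finally have main: "\<P>(\<omega> in M. significant N t (?L \<omega>) i) \<le> t * \<P>(\<omega> in M. i \<in> K \<omega>)"
    using card_N by (simp add: mult.left_commute[of t] mult_le_cancel_left_pos)
  \<comment> \<open>The equivalence is only almost sure: on a null set \<open>K\<close> may contain
    indices outside \<open>N\<close>, which the label vector does not record.\<close>
  have "AE \<omega> in M. (1 / real (card (K \<omega>)) * (\<Sum>k\<in>K \<omega>. of_bool (W k \<omega> \<ge> W i \<omega>)) \<le> t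
      \<and> i \<in> K \<omega>) \<longleftrightarrow> significant N t (?L \<omega>) i"
    using AE_subset_incl_support[OF K]
    by eventually_elim
      (use N i in \<open>auto simp: significant_def selected_labelled rank_pvalue_labelled N_def\<close>)
  moreover have event_meas: "Measurable.pred M (\<lambda>\<omega>.
      1 / real (card (K \<omega>)) * (\<Sum>k\<in>K \<omega>. of_bool (W k \<omega> \<ge> W i \<omega>)) \<le> t \<and> i \<in> K \<omega>)"
  \<comment> \<open>The index set of the sum is random. Freezing its value at \<open>A\<close>
    leaves a finite sum of measurable terms, and \<open>K\<close> takes only finitely many
    values.\<close>
  proof (rule measurable_compose_countable'[OF _ K, where f = "\<lambda>A \<omega>.
      1 / real (card A) * (\<Sum>k\<in>A. of_bool (W k \<omega> \<ge> W i \<omega>)) \<le> t \<and> i \<in> A"])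
    fix A assume "A \<in> Pow {1..n}"
    then have [measurable]: "W k \<in> borel_measurable M" if "k \<in> A" for k
      using that by (intro W) auto
    have [measurable]: "W i \<in> borel_measurable M"
      using i N by (intro W) auto
    show "Measurable.pred M (\<lambda>\<omega>. 1 / real (card A) * (\<Sum>k\<in>A. of_bool (W k \<omega> \<ge> W i \<omega>)) \<le> t \<and> i \<in> A)"
      unfolding of_bool_def by measurable
  qed (simp add: countable_finite)
  moreover have "Measurable.pred M (\<lambda>\<omega>. significant N t (?L \<omega>) i)"
    by (rule measurable_compose[OF L measurable_significant[OF i]])
  ultimately have "\<P>(\<omega> in M. 1 / real (card (K \<omega>)) * (\<Sum>k\<in>K \<omega>. of_bool (W k \<omega> \<ge> W i \<omega>)) \<le> t
      \<and> i \<in> K \<omega>) = \<P>(\<omega> in M. significant N t (?L \<omega>) i)"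
    using event_meas by (intro prob_eq_AE) auto
  then show ?thesis
    using main pos by (simp add: cond_prob_def pos_divide_le_eq)
qed

end
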